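(* Let $f:(0,\infty)\to\mathbb{R}$ be a convex function such that $f(1)=0$, $f\in C^1((0,1))\cap C^1((1,\infty))$, and $f'(x)<f'(y)$ for every $x<1<y$. Let $h_f:[0,\infty)\to[0,\infty)$ be the function such that $h_f(\chi(\lambda,\lambda'))=D_f(\lambda:\lambda')$ for all $\lambda,\lambda'\in\mathbb{H}$. Then $h_f$ is a strictly increasing function.
   Context: $\mathbb{H}=\{z\in\mathbb{C}:\operatorname{Im}z>0\}$. For $\lambda=l+is\in\mathbb{H}$, $p_\lambda(x)=\frac{s}{\pi((x-l)^2+s^2)}$, $x\in\mathbb{R}$, is the Cauchy density. $D_f(\lambda:\lambda'):=\int_{\mathbb{R}}p_\lambda(x)\,f\!\left(\frac{p_{\lambda'}(x)}{p_\lambda(x)}\right)dx$. $\chi(z,w):=\frac{|z-w|^2}{2\operatorname{Im}(z)\operatorname{Im}(w)}$ for $z,w\in\mathbb{H}$. The function $h_f$ is well defined: $D_f(\lambda:\lambda')$ depends on $(\lambda,\lambda')$ only through $\chi(\lambda,\lambda')$, and $\chi$ takes every value in $[0,\infty)$. *)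

theory Defs
  imports "HOL-Analysis.Analysis"
begin

definition upper_half_plane :: "complex set" where
  "upper_half_plane = {z. Im z > 0}"

text \<open>The location parameter is \<^term>\<open>Re l\<close> and the scale parameter is \<^term>\<open>Im l\<close>.\<close>

definition cauchy_density :: "complex \<Rightarrow> real \<Rightarrow> real" where
  "cauchy_density l x = Im l / (pi * ((x - Re l)\<^sup>2 + (Im l)\<^sup>2))"

text \<open>
  On the upper half-plane the density quotient is bounded and bounded away from 0, so for
  \<^term>\<open>f\<close> continuous on the positive reals the integrand is integrable; the integral then does
  not involve the junk value 0 of a non-integrable function, nor values of \<^term>\<open>f\<close>
  outside the positive reals.
\<close>

definition f_divergence :: "(real \<Rightarrow> real) \<Rightarrow> complex \<Rightarrow> complex \<Rightarrow> real" where
  "f_divergence f l l' =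
     (\<integral>x. cauchy_density l x * f (cauchy_density l' x / cauchy_density l x) \<partial>lborel)"

definition chi :: "complex \<Rightarrow> complex \<Rightarrow> real" where
  "chi z w = (cmod (z - w))\<^sup>2 / (2 * Im z * Im w)"

end

theory Submission imports Defs "HOL-Real_Asymp.Real_Asymp" begin

text \<open>
  Since the divergence depends only on \<open>\<chi>\<close>, take \<open>\<lambda> = \<i>\<close> and \<open>\<lambda>' = s\<i>\<close> with \<open>s \<ge> 1\<close>. The density
  quotient is then \<open>R\<^sub>s(x) = s(1 + x\<^sup>2)/(x\<^sup>2 + s\<^sup>2)\<close>, and for \<open>s < s'\<close> the functions \<open>R\<^sub>s\<close> and \<open>R\<^sub>s\<^sub>'\<close>
  cross exactly where \<open>x\<^sup>2 = s s'\<close>, with a common value \<open>\<rho>\<close>; on either side \<open>R\<^sub>s\<close> lies between \<open>\<rho>\<close>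
  and \<open>R\<^sub>s\<^sub>'\<close>. If \<open>k\<close> is a slope of a supporting line of \<open>f\<close> at \<open>\<rho>\<close>, convexity gives
  \<open>f(R\<^sub>s\<^sub>') - f(R\<^sub>s) \<ge> k (R\<^sub>s\<^sub>' - R\<^sub>s)\<close> pointwise, and the right-hand side integrates to 0 against the
  Cauchy density because both densities have mass 1. In case of equality of the integrals,
  continuity makes the pointwise inequality an equality everywhere; at \<open>x = 0\<close> this
  forces \<open>f' \<ge> k\<close> somewhere below 1, and at large \<open>x\<close> it forces \<open>f' \<le> k\<close> somewhere above 1,
  against the hypothesis on \<open>f'\<close>.
\<close>

section \<open>Supporting lines of convex functions\<close>

lemma convex_on_subgradient_exists:
  fixes f :: "real \<Rightarrow> real"
  assumes "convex_on S f" "open S" "r \<in> S"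
  obtains k where "\<And>y. y \<in> S \<Longrightarrow> f r + k * (y - r) \<le> f y"
proof
  fix y assume "y \<in> S"
  \<comment> \<open>The slope is the infimum of the chord slopes to the right of \<open>r\<close>,
    i.e. the right derivative of \<open>f\<close> at \<open>r\<close>.\<close>
  then show "f r + Inf ((\<lambda>t. (f r - f t) / (r - t)) ` ({r<..} \<inter> S)) * (y - r) \<le> f y"
    using assms by (intro convex_le_Inf_differential) (auto simp: interior_open)
qed

text \<open>The convex function \<open>f y - k * y\<close> is minimal at \<open>r\<close>, so it
  cannot decrease on the way from \<open>r\<close> through \<open>a\<close> to \<open>b\<close>,
  whichever side of \<open>r\<close> that is.\<close>

lemma convex_on_chord_ge_subgradient:
  fixes f :: "real \<Rightarrow> real"
  assumes f: "convex_on S f" and S: "r \<in> S" "b \<in> S"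
    and k: "\<And>y. y \<in> S \<Longrightarrow> f r + k * (y - r) \<le> f y"
    and a: "a \<in> closed_segment r b"
  shows "k * (b - a) \<le> f b - f a"
proof -
  obtain t where t: "0 \<le> t" "t \<le> 1" and a_eq: "a = (1 - t) * r + t * b"
    using a by (auto simp: in_segment)
  have "f a \<le> (1 - t) * f r + t * f b"
    using convex_onD[OF f t S] by (simp add: a_eq)
  also have "\<dots> \<le> (1 - t) * (f b - k * (b - r)) + t * f b"
    using k[OF S(2)] t by (intro add_right_mono mult_left_mono) auto
  also have "\<dots> = f b - k * (b - a)"
    by (simp add: a_eq algebra_simps)
  finally show ?thesis by simp
qed

text \<open>Up to the midpoint \<open>f\<close> gains at least what slope \<open>k\<close> gives,
  and beyond it at least what the tangent gives; a total gain of exactly \<open>k * (b - a)\<close>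
  leaves no room for a steeper tangent. The factor \<open>b - a\<close> is kept because its sign
  depends on the side of \<open>r\<close>.\<close>

lemma convex_on_tangent_at_midpoint:
  fixes f :: "real \<Rightarrow> real"
  assumes f: "convex_on S f" and S: "open S" "r \<in> S" "b \<in> S"
    and k: "\<And>y. y \<in> S \<Longrightarrow> f r + k * (y - r) \<le> f y"
    and a: "a \<in> closed_segment r b"
    and eq: "f b - f a = k * (b - a)"
    and D: "(f has_field_derivative D) (at ((a + b) / 2))"
  shows "D * (b - a) \<le> k * (b - a)"
proof -
  define m where "m = (a + b) / 2"
  have conv: "convex S"
    using f by (rule convex_on_imp_convex)
  have "a \<in> S"
    using closed_segment_subset[OF S(2,3) conv] a by blast
  have m_ab: "m \<in> closed_segment a b"
    by (auto simp: m_def closed_segment_eq_real_ivl field_simps)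
  then have m: "m \<in> S"
    using closed_segment_subset[OF \<open>a \<in> S\<close> S(3) conv] by blast
  have "a \<in> closed_segment r m"
    using a m_ab by (auto simp: closed_segment_eq_real_ivl split: if_splits)
  then have "k * (m - a) \<le> f m - f a"
    using convex_on_chord_ge_subgradient[OF f S(2) m k] by blast
  moreover have "f b - f m \<ge> D * (b - m)"
    using D S m conv
    by (intro convex_on_imp_above_tangent[OF f])
       (auto simp: interior_open m_def convex_connected intro: has_field_derivative_at_within)
  moreover have "b - m = (b - a) / 2" "m - a = (b - a) / 2"
    by (simp_all add: m_def field_simps)
  ultimately show ?thesis
    using eq by simp
qed

text \<open>By continuity the set where \<open>g\<close> is nonzero is open, and a nonempty open set
  is not null.\<close>

lemma continuous_AE_zero_imp_zero:
  fixes g :: "'a::euclidean_space \<Rightarrow> real"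
  assumes "continuous_on UNIV g" "AE x in lborel. g x = 0"
  shows "g x = 0"
proof (rule ccontr)
  assume "g x \<noteq> 0"
  have "open {x. g x \<noteq> 0}"
    using assms(1) by (intro open_Collect_neq) auto
  moreover have "{x. g x \<noteq> 0} \<in> null_sets lborel"
    using AE_iff_null_sets[of "{x. g x \<noteq> 0}" lborel] assms(2) calculation by auto
  then have "negligible {x. g x \<noteq> 0}"
    by (simp add: negligible_iff_null_sets null_sets_completionI)
  ultimately show False
    using open_not_negligible \<open>g x \<noteq> 0\<close> by blast
qed

section \<open>Cauchy densities and their mass\<close>

lemma cauchy_density_pos: "l \<in> upper_half_plane \<Longrightarrow> 0 < cauchy_density l x"
  by (auto simp: cauchy_density_def upper_half_plane_def intro!: divide_pos_pos mult_pos_pos add_nonneg_pos)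

lemma continuous_on_cauchy_density:
  "l \<in> upper_half_plane \<Longrightarrow> continuous_on UNIV (cauchy_density l)"
  unfolding cauchy_density_def
  by (intro continuous_intros) (auto simp: upper_half_plane_def add_nonneg_eq_0_iff)

lemma
  assumes l: "l \<in> upper_half_plane"
  shows integrable_cauchy_density: "integrable lborel (cauchy_density l)"
    and integral_cauchy_density: "integral\<^sup>L lborel (cauchy_density l) = 1"
proof -
  \<comment> \<open>The Cauchy distribution function shifted by 1/2: its limits are 1/2 and -1/2, so
    the mass is 1.\<close>
  define F where "F x = arctan ((x - Re l) / Im l) / pi" for x
  have s: "Im l > 0"
    using l by (simp add: upper_half_plane_def)
  have deriv: "(F has_real_derivative cauchy_density l x) (at x)" for x
  proof -
    have "1 + ((x - Re l) / Im l)\<^sup>2 = ((x - Re l)\<^sup>2 + (Im l)\<^sup>2) / (Im l)\<^sup>2"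
      using s by (simp add: power_divide add_divide_distrib)
    then have "inverse (1 + ((x - Re l) / Im l)\<^sup>2) * (1 / Im l) / pi = cauchy_density l x"
      using s by (simp add: cauchy_density_def power2_eq_square)
    moreover have "(F has_real_derivative inverse (1 + ((x - Re l) / Im l)\<^sup>2) * (1 / Im l) / pi) (at x)"
      unfolding F_def using s by (auto intro!: derivative_eq_intros)
    ultimately show ?thesis by simp
  qed
  have cont: "isCont (cauchy_density l) x" for x
    using continuous_on_cauchy_density[OF l] by (simp add: continuous_on_eq_continuous_at)
  have "LIM x at_top. (x - Re l) / Im l :> at_top" "LIM x at_bot. (x - Re l) / Im l :> at_bot"
    using s by real_asymp+
  then have "(F \<longlongrightarrow> pi / 2 / pi) at_top" "(F \<longlongrightarrow> - (pi / 2) / pi) at_bot"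
    unfolding F_def
    by - (intro tendsto_divide tendsto_const pi_neq_zero filterlim_compose[OF tendsto_arctan_at_top]
        filterlim_compose[OF tendsto_arctan_at_bot]; assumption)+
  then have lim: "((F \<circ> real_of_ereal) \<longlongrightarrow> 1 / 2) (at_left \<infinity>)"
      "((F \<circ> real_of_ereal) \<longlongrightarrow> - 1 / 2) (at_right (- \<infinity>))"
    by (simp_all add: ereal_tendsto_simps)
  have nonneg: "AE x in lborel. - \<infinity> < ereal x \<longrightarrow> ereal x < \<infinity> \<longrightarrow> 0 \<le> cauchy_density l x"
    using cauchy_density_pos[OF l] by (simp add: less_imp_le)
  note FTC = interval_integral_FTC_nonneg[OF _ deriv cont nonneg lim(2) lim(1)]
  show "integrable lborel (cauchy_density l)"
    using FTC(1) by (simp add: set_integrable_def)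
  show "integral\<^sup>L lborel (cauchy_density l) = 1"
    using FTC(2) by (simp add: interval_lebesgue_integral_def set_lebesgue_integral_def)
qed

section \<open>Density quotients along the imaginary axis\<close>

definition cauchy_ratio :: "real \<Rightarrow> real \<Rightarrow> real" where
  "cauchy_ratio s x = s * (1 + x\<^sup>2) / (x\<^sup>2 + s\<^sup>2)"

text \<open>This is \<open>cauchy_ratio s x\<close> with \<open>s * t\<close> substituted for the
  square of \<open>x\<close>, after cancelling \<open>s\<close>; it is symmetric in \<open>s\<close>
  and \<open>t\<close>.\<close>

definition cauchy_ratio_crossing :: "real \<Rightarrow> real \<Rightarrow> real" where
  "cauchy_ratio_crossing s t = (1 + s * t) / (s + t)"

lemma sum_squares_pos: "0 < s \<Longrightarrow> 0 < x\<^sup>2 + (s::real)\<^sup>2"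
  by (simp add: add_nonneg_pos)

lemma cauchy_density_ratio:
  assumes "0 < s"
  shows "cauchy_density (Complex 0 s) x / cauchy_density \<i> x = cauchy_ratio s x"
  using assms sum_squares_pos[OF assms, of x] sum_squares_pos[of 1 x]
  by (simp add: cauchy_density_def cauchy_ratio_def add.commute)

lemma cauchy_ratio_pos: "0 < s \<Longrightarrow> 0 < cauchy_ratio s x"
  by (simp add: cauchy_ratio_def add_pos_nonneg add_nonneg_pos)

lemma continuous_on_cauchy_ratio: "0 < s \<Longrightarrow> continuous_on UNIV (cauchy_ratio s)"
  unfolding cauchy_ratio_def by (intro continuous_intros) (auto simp: add_nonneg_eq_0_iff)

lemma cauchy_ratio_diff:
  assumes "0 < s" "0 < t"
  shows "cauchy_ratio t x - cauchy_ratio s x =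
    (t - s) * (1 + x\<^sup>2) / ((x\<^sup>2 + s\<^sup>2) * (x\<^sup>2 + t\<^sup>2)) * (x\<^sup>2 - s * t)"
proof -
  have "x\<^sup>2 + s\<^sup>2 \<noteq> 0" "x\<^sup>2 + t\<^sup>2 \<noteq> 0"
    using sum_squares_pos assms by (metis less_irrefl)+
  then show ?thesis
    by (simp add: cauchy_ratio_def divide_simps) (simp add: algebra_simps power2_eq_square)
qed

lemma cauchy_ratio_diff_crossing:
  assumes "0 < s" "0 < t"
  shows "cauchy_ratio s x - cauchy_ratio_crossing s t =
    (s\<^sup>2 - 1) / ((x\<^sup>2 + s\<^sup>2) * (s + t)) * (x\<^sup>2 - s * t)"
proof -
  have "x\<^sup>2 + s\<^sup>2 \<noteq> 0" "s + t \<noteq> 0"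
    using sum_squares_pos[OF assms(1), of x] assms by auto
  then show ?thesis
    by (simp add: cauchy_ratio_def cauchy_ratio_crossing_def divide_simps)
      (simp add: algebra_simps power2_eq_square)
qed

text \<open>Both successive differences are nonnegative multiples of the same factor, so they have
  the same sign; \<open>1 \<le> s\<close> is what makes \<open>B\<close> nonnegative.\<close>

lemma cauchy_ratio_between:
  assumes "1 \<le> s" "s \<le> t"
  shows "cauchy_ratio s x \<in> closed_segment (cauchy_ratio_crossing s t) (cauchy_ratio t x)"
proof -
  define A where "A = (t - s) * (1 + x\<^sup>2) / ((x\<^sup>2 + s\<^sup>2) * (x\<^sup>2 + t\<^sup>2))"
  define B where "B = (s\<^sup>2 - 1) / ((x\<^sup>2 + s\<^sup>2) * (s + t))"
  have AB: "0 \<le> A" "0 \<le> B"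
    using assms by (auto simp: A_def B_def)
  have "cauchy_ratio t x - cauchy_ratio s x = A * (x\<^sup>2 - s * t)"
    "cauchy_ratio s x - cauchy_ratio_crossing s t = B * (x\<^sup>2 - s * t)"
    using cauchy_ratio_diff cauchy_ratio_diff_crossing assms by (simp_all add: A_def B_def)
  moreover have "0 \<le> A * (x\<^sup>2 - s * t) \<and> 0 \<le> B * (x\<^sup>2 - s * t) \<or>
    A * (x\<^sup>2 - s * t) \<le> 0 \<and> B * (x\<^sup>2 - s * t) \<le> 0"
    using AB by (auto simp: zero_le_mult_iff mult_le_0_iff)
  ultimately show ?thesis
    by (auto simp: closed_segment_eq_real_ivl)
qed

text \<open>This keeps the arguments of \<open>f\<close> in a compact interval of positive reals,
  where \<open>f\<close> is bounded, so that the divergence integrand is dominated by a multiple of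
  the density.\<close>

lemma cauchy_ratio_bounds:
  assumes "1 \<le> s"
  shows "cauchy_ratio s x \<in> {1 / s..s}"
proof -
  have "0 < x\<^sup>2 + s\<^sup>2" "1 \<le> s\<^sup>2"
    using assms sum_squares_pos[of s x] by (auto simp: one_le_power)
  moreover have "0 \<le> x\<^sup>2 * (s\<^sup>2 - 1)"
    using \<open>1 \<le> s\<^sup>2\<close> by simp
  ultimately show ?thesis
    using assms by (auto simp: cauchy_ratio_def field_simps power2_eq_square)
qed

lemma
  fixes f :: "real \<Rightarrow> real"
  assumes f: "continuous_on {0<..} f" and s: "1 \<le> s"
  shows continuous_on_divergence_integrand:
      "continuous_on UNIV (\<lambda>x. cauchy_density \<i> x * f (cauchy_ratio s x))"
    and integrable_divergence_integrand:
      "integrable lborel (\<lambda>x. cauchy_density \<i> x * f (cauchy_ratio s x))"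
proof -
  have i: "\<i> \<in> upper_half_plane"
    by (simp add: upper_half_plane_def)
  show cont: "continuous_on UNIV (\<lambda>x. cauchy_density \<i> x * f (cauchy_ratio s x))"
    using s by (intro continuous_on_mult continuous_on_cauchy_density i
        continuous_on_compose2[OF f] continuous_on_cauchy_ratio) (auto intro: cauchy_ratio_pos)
  have "compact (f ` {1 / s..s})"
    using s by (intro compact_continuous_image continuous_on_subset[OF f])
      (auto intro: less_le_trans[of 0 "1 / s"])
  then obtain B where B: "\<And>y. y \<in> {1 / s..s} \<Longrightarrow> \<bar>f y\<bar> \<le> B"
    by (metis compact_imp_bounded bounded_iff image_eqI real_norm_def)
  show "integrable lborel (\<lambda>x. cauchy_density \<i> x * f (cauchy_ratio s x))"
  proof (rule Bochner_Integration.integrable_bound)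
    show "integrable lborel (\<lambda>x. cauchy_density \<i> x * B)"
      using integrable_cauchy_density[OF i] by simp
    show "(\<lambda>x. cauchy_density \<i> x * f (cauchy_ratio s x)) \<in> borel_measurable lborel"
      using borel_measurable_continuous_onI[OF cont] by simp
    show "AE x in lborel. norm (cauchy_density \<i> x * f (cauchy_ratio s x))
        \<le> norm (cauchy_density \<i> x * B)"
    proof (rule AE_I2)
      fix x
      show "norm (cauchy_density \<i> x * f (cauchy_ratio s x)) \<le> norm (cauchy_density \<i> x * B)"
        using B[OF cauchy_ratio_bounds[OF s, of x]] by (simp add: abs_mult mult_left_mono)
    qed
  qed
qed

section \<open>Strict growth of the divergence in the scale\<close>

lemma f_divergence_eq_cauchy_ratio:
  assumes "0 < s"
  shows "f_divergence f \<i> (Complex 0 s) = (\<integral>x. cauchy_density \<i> x * f (cauchy_ratio s x) \<partial>lborel)"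
  by (simp add: f_divergence_def cauchy_density_ratio[OF assms])

text \<open>For the identity the integrand collapses to the second density. This makes the linear
  term of the supporting line integrate to 0 later.\<close>

lemma f_divergence_id:
  assumes "l \<in> upper_half_plane" "l' \<in> upper_half_plane"
  shows "f_divergence (\<lambda>y. y) l l' = 1"
  using cauchy_density_pos[OF assms(1), THEN less_imp_neq] integral_cauchy_density[OF assms(2)]
  by (simp add: f_divergence_def)

lemma f_divergence_strict_mono_scale:
  fixes f :: "real \<Rightarrow> real"
  assumes f: "convex_on {0<..} f"
    and diff: "\<And>x. 0 < x \<Longrightarrow> x \<noteq> 1 \<Longrightarrow> f differentiable at x"
    and kink: "\<And>x y. 0 < x \<Longrightarrow> x < 1 \<Longrightarrow> 1 < y \<Longrightarrow> deriv f x < deriv f y"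
    and s: "1 \<le> s" and st: "s < t"
  shows "f_divergence f \<i> (Complex 0 s) < f_divergence f \<i> (Complex 0 t)"
proof -
  define r where "r = cauchy_ratio_crossing s t"
  define p where "p = cauchy_density \<i>"
  \<comment> \<open>The defect in the pointwise inequality, expanded into integrable terms so that
    the integral splits; \<open>gap_eq\<close> is the factored form that shows its sign.\<close>
  define gap where "gap k x = p x * f (cauchy_ratio t x) - p x * f (cauchy_ratio s x)
    - k * (p x * cauchy_ratio t x - p x * cauchy_ratio s x)" for k x
  have t: "1 \<le> t" and pos: "0 < s" "0 < t"
    using s st by auto
  have p: "0 < p x" for x
    unfolding p_def by (rule cauchy_density_pos) (simp add: upper_half_plane_def)
  have gap_eq: "gap k x = p x * (f (cauchy_ratio t x) - f (cauchy_ratio s x)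
    - k * (cauchy_ratio t x - cauchy_ratio s x))" for k x
    by (simp add: gap_def algebra_simps)
  have r: "r \<in> {0<..}"
    using pos by (auto simp: r_def cauchy_ratio_crossing_def add_pos_pos)
  obtain k where k: "\<And>y. y \<in> {0<..} \<Longrightarrow> f r + k * (y - r) \<le> f y"
    using convex_on_subgradient_exists[OF f open_greaterThan r] by blast
  have between: "cauchy_ratio s x \<in> closed_segment r (cauchy_ratio t x)" for x
    unfolding r_def using s st by (intro cauchy_ratio_between) auto
  have in_dom: "cauchy_ratio t x \<in> {0<..}" for x
    using cauchy_ratio_pos[OF pos(2)] by simp
  have gap_nonneg: "0 \<le> gap k x" for x
    using convex_on_chord_ge_subgradient[OF f r in_dom k between, of x] p[of x]
    by (simp add: gap_eq)
  have cont_f: "continuous_on {0<..} f"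
    using f by (intro convex_on_continuous) auto
  note int = integrable_divergence_integrand[folded p_def]
  note ints = int[OF cont_f s] int[OF cont_f t]
    int[OF continuous_on_id s] int[OF continuous_on_id t]
  have gap_integrable: "integrable lborel (gap k)"
    unfolding gap_def using ints by (intro Bochner_Integration.integrable_diff integrable_mult_right) auto
  have mass: "(\<integral>x. p x * cauchy_ratio u x \<partial>lborel) = 1" if "0 < u" for u
    using f_divergence_id[of \<i> "Complex 0 u"] f_divergence_eq_cauchy_ratio[OF that, of "\<lambda>y. y"] that
    by (simp add: upper_half_plane_def p_def)
  have gap_integral: "integral\<^sup>L lborel (gap k) =
      f_divergence f \<i> (Complex 0 t) - f_divergence f \<i> (Complex 0 s)"
    unfolding gap_def using ints pos
    by (simp add: f_divergence_eq_cauchy_ratio mass flip: p_def)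
  have "integral\<^sup>L lborel (gap k) \<noteq> 0"
  proof
    assume "integral\<^sup>L lborel (gap k) = 0"
    then have AE: "AE x in lborel. gap k x = 0"
      using integral_nonneg_eq_0_iff_AE[OF gap_integrable] gap_nonneg by simp
    have "continuous_on UNIV (gap k)"
      unfolding gap_def p_def using s t
      by (intro continuous_on_diff continuous_on_mult_left continuous_on_divergence_integrand
          continuous_on_divergence_integrand[where f = "\<lambda>y. y"] cont_f continuous_on_id)
    then have "gap k x = 0" for x
      using AE by (rule continuous_AE_zero_imp_zero)
    then have eq: "f (cauchy_ratio t x) - f (cauchy_ratio s x) = k * (cauchy_ratio t x - cauchy_ratio s x)" for x
      using p[of x] by (metis eq_iff_diff_eq_0 gap_eq less_irrefl mult_eq_0_iff)
    define m where "m x = (cauchy_ratio s x + cauchy_ratio t x) / 2" for x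
    have tangent: "deriv f (m x) * (cauchy_ratio t x - cauchy_ratio s x)
        \<le> k * (cauchy_ratio t x - cauchy_ratio s x)" if "m x \<noteq> 1" for x
    proof (rule convex_on_tangent_at_midpoint[OF f open_greaterThan r in_dom k between eq])
      have "0 < m x"
        using cauchy_ratio_pos[OF pos(1), of x] cauchy_ratio_pos[OF pos(2), of x] by (simp add: m_def)
      then show "(f has_real_derivative deriv f (m x)) (at ((cauchy_ratio s x + cauchy_ratio t x) / 2))"
        using diff[of "m x"] that by (simp add: m_def DERIV_deriv_iff_real_differentiable)
    qed
    \<comment> \<open>At 0 the quotients are \<open>1 / s\<close> and \<open>1 / t\<close>. The
      second lies strictly below 1, hence so does the midpoint, even for
      \<open>s = 1\<close>.\<close>
    have at_0: "cauchy_ratio u 0 = 1 / u" if "0 < u" for u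
      using that by (simp add: cauchy_ratio_def power2_eq_square)
    have inv: "1 / t < 1 / s" "1 / s \<le> 1" "0 < 1 / t"
      using s st pos by (auto intro: divide_strict_left_mono)
    moreover have "2 * m 0 = 1 / s + 1 / t"
      using pos by (simp add: m_def at_0)
    ultimately have m0: "0 < m 0" "m 0 < 1"
      by linarith+
    \<comment> \<open>The increment of the quotient is negative here, so cancelling it reverses the
      inequality.\<close>
    have lower: "k \<le> deriv f (m 0)"
      using tangent[of 0] m0 inv at_0 pos by (simp add: mult_le_cancel_right)
    \<comment> \<open>An explicit point beyond the crossing, where the increment is
      positive.\<close>
    define z where "z = s * t + 1"
    have z: "s * t < z\<^sup>2"
      using pos by (simp add: z_def power2_eq_square algebra_simps add_pos_nonneg)
    have less: "cauchy_ratio s z < cauchy_ratio t z"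
    proof -
      have "0 < cauchy_ratio t z - cauchy_ratio s z"
        unfolding cauchy_ratio_diff[OF pos] using z st sum_squares_pos pos
        by (intro mult_pos_pos divide_pos_pos) (auto intro: add_pos_nonneg)
      then show ?thesis by simp
    qed
    have "s \<le> s * t"
      using pos t by simp
    \<comment> \<open>Cleared of denominators, \<open>1 \<le> cauchy_ratio s z\<close> is exactly
      this inequality.\<close>
    then have "0 \<le> (s - 1) * (z\<^sup>2 - s)"
      using s z by (intro mult_nonneg_nonneg) linarith+
    then have "1 \<le> cauchy_ratio s z"
      using sum_squares_pos[OF pos(1), of z]
      by (simp add: cauchy_ratio_def field_simps power2_eq_square)
    with less have mz: "1 < m z"
      by (simp add: m_def)
    have "deriv f (m z) \<le> k"
      using tangent[of z] mz less by (simp add: mult_le_cancel_right)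
    then show False
      using lower kink[OF m0 mz] by simp
  qed
  moreover have "0 \<le> integral\<^sup>L lborel (gap k)"
    using gap_nonneg by simp
  ultimately show ?thesis
    unfolding gap_integral by simp
qed

lemma chi_scale: "chi \<i> (Complex 0 s) = (s - 1)\<^sup>2 / (2 * s)"
  by (simp add: chi_def cmod_power2 power2_commute)

theorem theorem3:
  fixes f h :: "real \<Rightarrow> real"
  assumes "convex_on {0<..} f"
    and "f 1 = 0"
    and "f C1_differentiable_on {0<..<1}"
    and "f C1_differentiable_on {1<..}"
    and "\<And>x y. 0 < x \<Longrightarrow> x < 1 \<Longrightarrow> 1 < y \<Longrightarrow> deriv f x < deriv f y"
    and "h \<in> {0..} \<rightarrow> {0..}"
    and "\<And>l l'. l \<in> upper_half_plane \<Longrightarrow> l' \<in> upper_half_plane \<Longrightarrow>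
           h (chi l l') = f_divergence f l l'"
  shows "strict_mono_on {0..} h"
proof (rule strict_mono_onI)
  fix c d :: real
  assume cd: "c \<in> {0..}" "d \<in> {0..}" "c < d"
  \<comment> \<open>The larger root of the quadratic equation in \<open>s\<close> saying that
    \<open>(s - 1)\<^sup>2 / (2 * s)\<close> equals \<open>c\<close>; it is at least 1 and increases
    with \<open>c\<close>.\<close>
  define scale where "scale c = 1 + c + sqrt ((1 + c)\<^sup>2 - 1)" for c :: real
  have scale_ge: "1 \<le> scale u" if "0 \<le> u" for u
    using that by (simp add: scale_def one_le_power)
  have "chi \<i> (Complex 0 (scale u)) = u" if "0 \<le> u" for u
  proof -
    have "(sqrt ((1 + u)\<^sup>2 - 1))\<^sup>2 = (1 + u)\<^sup>2 - 1"
      using that by (simp add: one_le_power)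
    then have "(scale u - 1)\<^sup>2 = 2 * u * scale u"
      by (simp add: scale_def power2_eq_square algebra_simps)
    then show ?thesis
      using scale_ge[OF that] by (simp add: chi_scale)
  qed
  then have h: "h u = f_divergence f \<i> (Complex 0 (scale u))" if "0 \<le> u" for u
    using assms(7)[of \<i> "Complex 0 (scale u)"] scale_ge[OF that] that
    by (simp add: upper_half_plane_def)
  have diff: "f differentiable at x" if "0 < x" "x \<noteq> 1" for x
    using assms(3,4) that
    by (cases "x < 1") (auto simp: C1_differentiable_on_eq)
  have "scale c < scale d"
    using cd by (simp add: scale_def add_less_le_mono power_mono)
  then have "f_divergence f \<i> (Complex 0 (scale c)) < f_divergence f \<i> (Complex 0 (scale d))"
    using cd scale_ge by (intro f_divergence_strict_mono_scale assms(1,5) diff) auto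
  then show "h c < h d"
    using h cd by simp
qed

end
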